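(* Let $k$ be an odd positive integer and, for odd positive $m$, let $F_m:\mathbb{N}\to\mathbb{N}$ be given by $F_m(n)=\frac{3n+m}{2}$ if $n$ is odd and $F_m(n)=\frac{n}{2}$ if $n$ is even. Let $C$ be a cycle of $F_k$ with minimal element $T_0$ and orb sequence $(u_1,d_1,\dots,u_s,d_s)$ read from $T_0$. Then for every odd positive integer $r$, the set $rC=\{rx:x\in C\}$ is a cycle of $F_{rk}$, its minimal element is $rT_0$, and its orb sequence read from $rT_0$ is the same $(u_1,d_1,\dots,u_s,d_s)$.
   Context: A cycle of $F_m$ is a set $\{x,F_m(x),\dots,F_m^{p-1}(x)\}$ with $x\in\mathbb{N}$, $p\ge1$, $F_m^p(x)=x$. The orb sequence read from an odd element $T_0$ of a cycle is the list of lengths of alternating maximal blocks of consecutive odd iterates ($u_i$) and consecutive even iterates ($d_i$) encountered when iterating from $T_0$ once around the cycle. *)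

theory Defs
  imports Main
begin

text \<open>For odd m both divisions are exact.\<close>
definition F :: "nat \<Rightarrow> nat \<Rightarrow> nat" where
  "F m n = (if odd n then (3 * n + m) div 2 else n div 2)"

text \<open>The exponent p is not required to be the minimal period, so in general the length
  of the cycle is card C and not p.\<close>
definition is_cycle :: "nat \<Rightarrow> nat set \<Rightarrow> bool" where
  "is_cycle m C \<longleftrightarrow> (\<exists>x p. p \<ge> 1 \<and> (F m ^^ p) x = x \<and> C = {(F m ^^ i) x | i. i < p})"

text \<open>Splits a list into its maximal blocks of consecutive odd and of consecutive even
  entries and returns the lengths as pairs (u, d), where u counts an odd block and d the
  even block following it. If the list starts with an odd and ends with an even entry,
  all u and d are positive.\<close>
function orb_lengths :: "nat list \<Rightarrow> (nat \<times> nat) list" where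
  "orb_lengths [] = []"
| "orb_lengths (x # xs) =
     (let ys = dropWhile odd (x # xs) in
      (length (takeWhile odd (x # xs)), length (takeWhile even ys))
        # orb_lengths (dropWhile even ys))"
  by pat_completeness auto
termination
proof (relation "measure length", simp)
  fix x :: nat and xs ys
  assume ys: "ys = dropWhile odd (x # xs)"
  have "length (dropWhile even ys) < length (x # xs)"
  proof (cases "odd x")
    case True
    then have "ys = dropWhile odd xs" using ys by simp
    then show ?thesis
      by (metis length_dropWhile_le le_trans length_Cons less_Suc_eq_le)
  next
    case False
    then have "dropWhile even ys = dropWhile even xs" using ys by simp
    then show ?thesis
      by (metis length_dropWhile_le length_Cons less_Suc_eq_le)
  qed
  then show "(dropWhile even ys, x # xs) \<in> measure length" by simp
qed

text \<open>The pair list [(u1, d1), ..., (us, ds)] encodes (u1, d1, ..., us, ds). Iterating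
  card C - 1 times from T in C visits each element of C exactly once. If T is the least
  element of C and T > 0, then T is odd and its predecessor in C is even, so no block is
  cut at the ends of the list.\<close>
definition orb_sequence :: "nat \<Rightarrow> nat set \<Rightarrow> nat \<Rightarrow> (nat \<times> nat) list" where
  "orb_sequence m C T = orb_lengths (map (\<lambda>i. (F m ^^ i) T) [0..<card C])"

end

theory Submission imports Defs
begin

text \<open>Multiplication by the odd number \<open>r\<close> preserves parity, so \<open>n\<close>
  and \<open>r * n\<close> fall into the same branch of the map, and in both branches it carries
  \<open>F k\<close> to \<open>F (r * k)\<close> (\<open>F_scale\<close>). Hence it carries orbits
  to orbits (\<open>funpow_F_scale\<close>). It is also increasing, so minima correspond, and
  injective, so cycle lengths agree. Orb sequences see only the parities of the iterates
  (\<open>orb_lengths_scale\<close>) and therefore coincide.\<close>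

lemma F_scale:
  assumes "odd k" and "odd r"
  shows "F (r * k) (r * n) = r * F k n"
proof (cases "odd n")
  case True
  \<comment> \<open>The factor \<open>r\<close> may be moved inside \<open>div\<close> only because
    this division is exact.\<close>
  then have "2 dvd 3 * n + k" using \<open>odd k\<close> by simp
  then show ?thesis
    using True \<open>odd r\<close> div_mult_swap[of 2 "3 * n + k" r]
    by (simp add: F_def algebra_simps)
next
  case False
  then show ?thesis by (simp add: F_def div_mult_swap)
qed

lemma funpow_F_scale:
  assumes "odd k" and "odd r"
  shows "(F (r * k) ^^ i) (r * n) = r * (F k ^^ i) n"
  by (induction i) (simp_all add: F_scale[OF assms])

text \<open>Block boundaries are decided by parity tests alone, and an odd factor changes none of
  them.\<close>

lemma orb_lengths_scale:
  assumes "odd r"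
  shows "orb_lengths (map ((*) r) xs) = orb_lengths xs"
proof (induction xs rule: orb_lengths.induct)
  case 1
  then show ?case by simp
next
  case (2 x xs)
  have parity: "odd \<circ> (*) r = odd" "even \<circ> (*) r = even"
    using assms by auto
  have "orb_lengths (map ((*) r) (x # xs)) =
    (let ys = dropWhile odd (map ((*) r) (x # xs)) in
      (length (takeWhile odd (map ((*) r) (x # xs))), length (takeWhile even ys))
        # orb_lengths (dropWhile even ys))"
    by (simp only: list.map orb_lengths.simps)
  \<comment> \<open>By \<open>parity\<close>, cutting off blocks commutes with scaling, so the
    remaining suffix is again a scaled list and the induction hypothesis applies to it.\<close>
  also have "\<dots> = orb_lengths (x # xs)"
    by (simp only: Let_def takeWhile_map dropWhile_map parity length_map
        2[OF refl] orb_lengths.simps)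
  finally show ?case .
qed

theorem theorem8:
  fixes k r T0 :: nat and C :: "nat set" and uds :: "(nat \<times> nat) list"
  assumes "odd k" and "is_cycle k C" and "T0 = Min C" and "orb_sequence k C T0 = uds"
    and "odd r"
  shows "is_cycle (r * k) ((\<lambda>x. r * x) ` C)
    \<and> Min ((\<lambda>x. r * x) ` C) = r * T0
    \<and> orb_sequence (r * k) ((\<lambda>x. r * x) ` C) (r * T0) = uds"
proof (intro conjI)
  note scale = funpow_F_scale[OF \<open>odd k\<close> \<open>odd r\<close>]
  obtain x p where p: "p \<ge> 1" and x: "(F k ^^ p) x = x"
    and C: "C = (\<lambda>i. (F k ^^ i) x) ` {..<p}"
    using \<open>is_cycle k C\<close> by (auto simp: is_cycle_def)
  \<comment> \<open>The scaled cycle is generated by \<open>r * x\<close> with the same exponent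
    \<open>p\<close>.\<close>
  have "(\<lambda>x. r * x) ` C = {(F (r * k) ^^ i) (r * x) | i. i < p}"
    by (auto simp: C scale)
  moreover have "(F (r * k) ^^ p) (r * x) = r * x"
    by (simp only: scale x)
  ultimately show "is_cycle (r * k) ((\<lambda>x. r * x) ` C)"
    unfolding is_cycle_def using p by blast
  have "finite C" and "C \<noteq> {}"
    using p by (auto simp: C lessThan_empty_iff)
  then show "Min ((\<lambda>x. r * x) ` C) = r * T0"
    unfolding \<open>T0 = Min C\<close> by (intro mono_Min_commute[symmetric]) (auto intro: monoI)
  \<comment> \<open>An odd \<open>r\<close> is nonzero. Equal cardinalities make both orb sequences
    read off the same number of iterates.\<close>
  have "inj_on (\<lambda>x. r * x) C"
    using \<open>odd r\<close> by (auto intro!: inj_onI elim: oddE)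
  then have "card ((\<lambda>x. r * x) ` C) = card C"
    by (rule card_image)
  then have "orb_sequence (r * k) ((\<lambda>x. r * x) ` C) (r * T0) =
      orb_lengths (map ((*) r) (map (\<lambda>i. (F k ^^ i) T0) [0..<card C]))"
    by (simp add: orb_sequence_def scale o_def)
  then show "orb_sequence (r * k) ((\<lambda>x. r * x) ` C) (r * T0) = uds"
    using assms(4) by (simp only: orb_lengths_scale[OF \<open>odd r\<close>] orb_sequence_def)
qed

end
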